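(* Let $1\le p<\infty$ and let $S$ be a measure preserving $m$-transformation on a normalized measure space $(X,\mathcal{B},\mu)$. If $f\in\mathcal{L}^p(X,\mathcal{B},\mu)$, then there exists $f^*\in\mathcal{L}^p(X,\mathcal{B},\mu)$ such that $Uf^*=f^*$ $\mu$-a.e. and $\|f^*-A_n(f)\|_p\to0$ as $n\to\infty$.
   Context: $(X,\mathcal{B},\mu)$ is a normalized measure space, i.e. $\mu(X)=1$, and $m$ is a positive integer. An $m$-transformation $S:X\to X$ is a multivalued map assigning to each $x\in X$ a subset $S(x)\subset X$ with $1\le |S(x)|\le m$, where $|A|$ is the number of elements of $A$. For $B\subset X$ and $k,l\in\mathbb{N}$ put $S^{-1}_{k;l}(B)=\{x\in X: |S(x)|=k,\ |S(x)\cap B|=l\}$. $S$ is measurable if $S^{-1}_{k;l}(B)\in\mathcal{B}$ for all $B\in\mathcal{B}$ and $k,l\in\mathbb{N}$. Put $K(x,B)=\frac{1}{|S(x)|}\sum_{y\in S(x)}\chi_B(y)$ and $S\mu(B)=\int_X K(x,B)\,\mathrm{d}\mu(x)$ for $B\in\mathcal{B}$. $S$ is measure preserving if it is measurable and $S\mu=\mu$. For a function $f$ on $X$, $Uf(x)=\frac{1}{|S(x)|}\sum_{y\in S(x)}f(y)$, and $A_n(f)=\frac1n\sum_{k=0}^{n-1}U^kf$ for $n=1,2,\ldots$. *)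

theory Defs
  imports "HOL-Probability.Probability"
begin

definition m_transformation :: "nat \<Rightarrow> 'a measure \<Rightarrow> ('a \<Rightarrow> 'a set) \<Rightarrow> bool" where
  "m_transformation m M S \<longleftrightarrow>
     (\<forall>x\<in>space M. S x \<subseteq> space M \<and> finite (S x) \<and> 1 \<le> card (S x) \<and> card (S x) \<le> m)"

definition mt_preimage :: "'a measure \<Rightarrow> ('a \<Rightarrow> 'a set) \<Rightarrow> nat \<Rightarrow> nat \<Rightarrow> 'a set \<Rightarrow> 'a set" where
  "mt_preimage M S k l B = {x \<in> space M. card (S x) = k \<and> card (S x \<inter> B) = l}"

text \<open>Excluding \<open>k = 0\<close> or \<open>l = 0\<close> would give an equivalent condition: for \<open>k = 0\<close> the set is
  empty, and \<open>{x. card (S x) = k}\<close> is the case \<open>B = space M\<close>, \<open>l = k\<close>.\<close>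

definition mt_measurable :: "'a measure \<Rightarrow> ('a \<Rightarrow> 'a set) \<Rightarrow> bool" where
  "mt_measurable M S \<longleftrightarrow> (\<forall>B\<in>sets M. \<forall>k l. mt_preimage M S k l B \<in> sets M)"

definition mt_kernel :: "('a \<Rightarrow> 'a set) \<Rightarrow> 'a \<Rightarrow> 'a set \<Rightarrow> real" where
  "mt_kernel S x B = (1 / real (card (S x))) * (\<Sum>y\<in>S x. indicator B y)"

definition mt_push :: "('a \<Rightarrow> 'a set) \<Rightarrow> 'a measure \<Rightarrow> 'a set \<Rightarrow> real" where
  "mt_push S M B = (\<integral>x. mt_kernel S x B \<partial>M)"

definition mt_measure_preserving :: "'a measure \<Rightarrow> ('a \<Rightarrow> 'a set) \<Rightarrow> bool" where
  "mt_measure_preserving M S \<longleftrightarrow>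
     mt_measurable M S \<and> (\<forall>B\<in>sets M. mt_push S M B = measure M B)"

definition mt_U :: "('a \<Rightarrow> 'a set) \<Rightarrow> ('a \<Rightarrow> 'b::real_normed_field) \<Rightarrow> 'a \<Rightarrow> 'b" where
  "mt_U S f x = (1 / of_nat (card (S x))) * (\<Sum>y\<in>S x. f y)"

definition mt_average :: "('a \<Rightarrow> 'a set) \<Rightarrow> nat \<Rightarrow> ('a \<Rightarrow> 'b::real_normed_field) \<Rightarrow> 'a \<Rightarrow> 'b" where
  "mt_average S n f x = (1 / of_nat n) * (\<Sum>k<n. (mt_U S ^^ k) f x)"

text \<open>The norm takes values in \<open>[0, \<infinity>]\<close>, so that a function outside \<open>L\<^sup>p\<close> has norm \<open>\<infinity>\<close>
  rather than the default value of a Bochner integral. It is meant for measurable \<open>f\<close>.\<close>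

definition Lp_norm :: "real \<Rightarrow> 'a measure \<Rightarrow> ('a \<Rightarrow> 'b::real_normed_vector) \<Rightarrow> ennreal" where
  "Lp_norm p M f =
     (let I = (\<integral>\<^sup>+x. ennreal (norm (f x) powr p) \<partial>M)
      in if I = \<infinity> then \<infinity> else ennreal (enn2real I powr (1 / p)))"

definition Lp_space :: "real \<Rightarrow> 'a measure \<Rightarrow> ('a \<Rightarrow> 'b::real_normed_vector) set" where
  "Lp_space p M = {f \<in> borel_measurable M. Lp_norm p M f < \<infinity>}"

end

theory Submission
  imports Defs
begin

text \<open>
  By Jensen's inequality and invariance of the measure, \<open>U\<close> and all averages \<open>A\<^sub>n\<close> are contractions
  for \<open>\<integral>|f|\<^sup>p\<close>. For \<open>f\<close> bounded by \<open>C\<close>, telescoping gives \<open>|A\<^sub>k A\<^sub>n f - A\<^sub>k f| \<le> 2 C n / k\<close>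
  pointwise. With \<open>\<mu>\<close> the infimum of \<open>E\<^sub>n = \<integral>|A\<^sub>n f|\<^sup>2\<close>, contractivity of \<open>A\<^sub>k\<close> for \<open>k \<longrightarrow> \<infinity>\<close> therefore
  yields both \<open>E\<^sub>k \<longrightarrow> \<mu>\<close> and \<open>\<mu> \<le> \<integral>|(A\<^sub>i f + A\<^sub>j f) / 2|\<^sup>2\<close>, so that by the parallelogram law the
  averages are Cauchy in \<open>L\<^sup>2\<close>, and, being bounded, in \<open>L\<^sup>p\<close>. Truncation extends this to all
  \<open>f \<in> L\<^sup>p\<close>, and the limit is invariant since \<open>U A\<^sub>n f - A\<^sub>n f = (U\<^sup>n f - f) / n\<close> tends to \<open>0\<close>.
  The integral \<open>\<integral>|f|\<^sup>p\<close> replaces the norm throughout: its quasi-triangle inequality with constant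
  \<open>3\<^sup>p\<close> suffices, so Minkowski's inequality is not needed.
\<close>

section \<open>Inequalities for powers\<close>

text \<open>On the open half-line this is \<open>powr_convex\<close>. When \<open>x\<close> or
  \<open>y\<close> is 0, the claim reduces to \<open>(s * z) powr p \<le> s * z powr p\<close>,
  which holds since \<open>s powr p \<le> s\<close> for \<open>s\<close> between 0 and 1.\<close>

lemma convex_on_powr_atLeast:
  fixes p :: real
  assumes "1 \<le> p"
  shows "convex_on {0..} (\<lambda>x::real. x powr p)"
proof (rule convex_onI)
  show "convex {0::real..}" by simp
next
  fix t x y :: real
  assume t: "0 < t" "t < 1" and x: "x \<in> {0..}" and y: "y \<in> {0..}"
  have shrink: "(s * z) powr p \<le> s * z powr p" if "0 < s" "s < 1" "0 \<le> z" for s z :: real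
    using powr_le_one_le[of s p] that assms by (simp add: powr_mult mult_right_mono)
  show "((1 - t) *\<^sub>R x + t *\<^sub>R y) powr p \<le> (1 - t) * x powr p + t * y powr p"
  proof (cases "x = 0 \<or> y = 0")
    case True
    then show ?thesis
      using shrink[of t y] shrink[of "1 - t" x] t x y by auto
  next
    case False
    then show ?thesis
      using convex_onD[OF powr_convex[OF assms], of t x y] t x y by auto
  qed
qed

text \<open>Triangle inequality followed by Jensen's inequality with equal weights. It serves twice:
  over the set \<open>S x\<close> for \<open>mt_U\<close>, and over \<open>{..<n}\<close> for
  \<open>mt_average\<close>. For empty \<open>I\<close> both sides are 0.\<close>

lemma norm_mean_powr_le:
  fixes f :: "'i \<Rightarrow> 'b::real_normed_vector" and p :: real
  assumes "1 \<le> p" and "finite I"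
  shows "norm ((1 / real (card I)) *\<^sub>R (\<Sum>i\<in>I. f i)) powr p
    \<le> (1 / real (card I)) * (\<Sum>i\<in>I. norm (f i) powr p)"
proof (cases "I = {}")
  case False
  with assms have c: "0 < real (card I)" by (simp add: card_gt_0_iff)
  have "norm ((1 / real (card I)) *\<^sub>R (\<Sum>i\<in>I. f i)) \<le> (\<Sum>i\<in>I. (1 / real (card I)) *\<^sub>R norm (f i))"
    using norm_sum[of f I] c by (simp add: divide_right_mono sum_divide_distrib[symmetric])
  then have "norm ((1 / real (card I)) *\<^sub>R (\<Sum>i\<in>I. f i)) powr p
      \<le> (\<Sum>i\<in>I. (1 / real (card I)) *\<^sub>R norm (f i)) powr p"
    using assms by (intro powr_mono2) auto
  also have "\<dots> \<le> (\<Sum>i\<in>I. (1 / real (card I)) * norm (f i) powr p)"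
    by (rule convex_on_sum[OF assms(2) False convex_on_powr_atLeast[OF assms(1)]]) (use c in auto)
  finally show ?thesis by (simp add: sum_distrib_left)
qed simp

text \<open>The norm of the sum is at most three times the largest of the three norms, and the
  \<open>p\<close>-th power of that largest norm is one of the summands on the right.\<close>

lemma norm_add3_powr_le:
  fixes a b c :: "'b::real_normed_vector" and p :: real
  assumes "1 \<le> p"
  shows "norm (a + b + c) powr p \<le> 3 powr p * (norm a powr p + norm b powr p + norm c powr p)"
proof -
  define t where "t = max (norm a) (max (norm b) (norm c))"
  have t: "norm a \<le> t" "norm b \<le> t" "norm c \<le> t" "t \<in> {norm a, norm b, norm c}"
    by (auto simp: t_def max_def)
  have "norm (a + b + c) powr p \<le> (3 * t) powr p"
    using assms norm_triangle_ineq[of "a + b" c] norm_triangle_ineq[of a b] t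
    by (intro powr_mono2) auto
  also have "\<dots> = 3 powr p * t powr p"
    using t by (auto simp: powr_mult)
  also have "\<dots> \<le> 3 powr p * (norm a powr p + norm b powr p + norm c powr p)"
    using t(4) by (intro mult_left_mono) auto
  finally show ?thesis .
qed

section \<open>Integrals of powers\<close>

text \<open>The \<open>p\<close>-th power of \<open>Lp_norm\<close>. Without the root, infinite
  values need no separate case and the limit theorems for \<open>nn_integral\<close> apply
  directly.\<close>

definition powr_integral :: "real \<Rightarrow> 'a measure \<Rightarrow> ('a \<Rightarrow> 'b::real_normed_vector) \<Rightarrow> ennreal" where
  "powr_integral p M f = (\<integral>\<^sup>+x. ennreal (norm (f x) powr p) \<partial>M)"

lemma powr_integral_minus_commute:
  "powr_integral p M (\<lambda>x. f x - g x) = powr_integral p M (\<lambda>x. g x - f x)"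
  by (simp add: powr_integral_def norm_minus_commute)

lemma powr_integral_add3_le:
  fixes f g h :: "'a \<Rightarrow> 'b::{real_normed_vector, second_countable_topology}"
  assumes "1 \<le> p"
    and [measurable]: "f \<in> borel_measurable M" "g \<in> borel_measurable M" "h \<in> borel_measurable M"
  shows "powr_integral p M (\<lambda>x. f x + g x + h x)
    \<le> ennreal (3 powr p) * (powr_integral p M f + powr_integral p M g + powr_integral p M h)"
proof -
  have "powr_integral p M (\<lambda>x. f x + g x + h x) \<le>
      (\<integral>\<^sup>+x. ennreal (3 powr p) * (ennreal (norm (f x) powr p) + ennreal (norm (g x) powr p)
        + ennreal (norm (h x) powr p)) \<partial>M)"
    unfolding powr_integral_def
    by (intro nn_integral_mono)
      (simp add: norm_add3_powr_le[OF assms(1)] ennreal_leI flip: ennreal_mult ennreal_plus)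
  also have "\<dots> = ennreal (3 powr p) * (powr_integral p M f + powr_integral p M g + powr_integral p M h)"
    unfolding powr_integral_def by (simp add: nn_integral_cmult nn_integral_add)
  finally show ?thesis .
qed

lemma powr_integral_eq_0:
  fixes f :: "'a \<Rightarrow> 'b::{real_normed_vector, second_countable_topology}"
  assumes [measurable]: "f \<in> borel_measurable M" and "powr_integral p M f = 0"
  shows "AE x in M. f x = 0"
proof -
  have "AE x in M. ennreal (norm (f x) powr p) = 0"
    using assms(2) unfolding powr_integral_def by (subst (asm) nn_integral_0_iff_AE) auto
  then show ?thesis by eventually_elim simp
qed

lemma Lp_norm_less_top_iff: "Lp_norm p M f < \<infinity> \<longleftrightarrow> powr_integral p M f < \<infinity>"
  by (auto simp: Lp_norm_def powr_integral_def Let_def less_top[symmetric])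

text \<open>Integrals tending to 0 are eventually finite, so the infinite branch of
  \<open>Lp_norm\<close> is eventually inactive, and the \<open>p\<close>-th root is continuous at
  0.\<close>

lemma Lp_norm_tendsto_0:
  assumes "0 < p" and lim: "(\<lambda>n. powr_integral p M (f n)) \<longlonglongrightarrow> 0"
  shows "(\<lambda>n. Lp_norm p M (f n)) \<longlonglongrightarrow> 0"
proof -
  have "(\<lambda>n. enn2real (powr_integral p M (f n)) powr (1 / p)) \<longlonglongrightarrow> 0 powr (1 / p)"
    using lim assms(1) by (intro tendsto_powr' tendsto_enn2real) auto
  then have "(\<lambda>n. ennreal (enn2real (powr_integral p M (f n)) powr (1 / p))) \<longlonglongrightarrow> 0"
    by (simp add: ennreal_tendsto_0_iff)
  moreover have "eventually (\<lambda>n. powr_integral p M (f n) < \<infinity>) sequentially"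
    using order_tendstoD(2)[OF lim, of \<infinity>] by simp
  then have "eventually (\<lambda>n. Lp_norm p M (f n)
      = ennreal (enn2real (powr_integral p M (f n)) powr (1 / p))) sequentially"
    by eventually_elim (simp add: Lp_norm_def powr_integral_def Let_def)
  ultimately show ?thesis by (simp add: tendsto_cong)
qed

section \<open>Comparison with the integral of the norm, and completeness\<close>

lemma (in prob_space) integrable_of_powr_integral:
  fixes f :: "'a \<Rightarrow> 'b::{banach, second_countable_topology}"
  assumes "1 \<le> p" and [measurable]: "f \<in> borel_measurable M" and "powr_integral p M f < \<infinity>"
  shows "integrable M f"
proof -
  have int: "integrable M (\<lambda>x. norm (f x) powr p)"
    using assms(3) by (intro integrableI_bounded) (auto simp: powr_integral_def)
  have le: "norm (f x) \<le> 1 + norm (f x) powr p" for x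
  proof (cases "norm (f x) \<le> 1")
    case False
    then have "norm (f x) powr 1 \<le> norm (f x) powr p"
      using assms(1) by (intro powr_mono) auto
    then show ?thesis by simp
  qed (simp add: add_increasing2)
  show ?thesis
    by (rule Bochner_Integration.integrable_bound[where f="\<lambda>x. 1 + norm (f x) powr p"])
      (use le int in auto)
qed

text \<open>A substitute for Hoelder's inequality: where the norm exceeds \<delta>, it equals
  \<open>norm (f x) powr (1 - p) * norm (f x) powr p\<close>, and the exponent \<open>1 - p\<close>
  is not positive. As \<delta> is free, it can be fixed first and \<open>e\<close> made small
  afterwards.\<close>

lemma (in prob_space) norm_integral_le_powr_integral:
  fixes f :: "'a \<Rightarrow> 'b::{banach, second_countable_topology}"
  assumes "1 \<le> p" and [measurable]: "f \<in> borel_measurable M" and "0 < \<delta>"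
    and "powr_integral p M f < ennreal e"
  shows "(\<integral>x. norm (f x) \<partial>M) \<le> \<delta> + \<delta> powr (1 - p) * e"
proof -
  have fin: "powr_integral p M f < \<infinity>"
    using assms(4) by (rule less_trans) (simp add: less_top)
  have e: "0 < e" using assms(4) by (metis ennreal_neg not_le not_less_zero)
  have int: "integrable M (\<lambda>x. norm (f x) powr p)"
    using fin by (intro integrableI_bounded) (auto simp: powr_integral_def)
  have I: "(\<integral>x. norm (f x) powr p \<partial>M) \<le> e"
    using assms(4) e nn_integral_eq_integral[OF int]
    by (simp add: powr_integral_def ennreal_less_iff)
  have le: "norm (f x) \<le> \<delta> + \<delta> powr (1 - p) * norm (f x) powr p" for x
  proof (cases "norm (f x) \<le> \<delta>")
    case False
    then have pos: "0 < norm (f x)" using assms(3) by linarith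
    then have "norm (f x) = norm (f x) powr (1 - p) * norm (f x) powr p"
      by (simp flip: powr_add)
    also have "\<dots> \<le> \<delta> powr (1 - p) * norm (f x) powr p"
      using False assms pos by (intro mult_right_mono powr_mono2') auto
    finally show ?thesis using assms(3) by linarith
  qed (simp add: add_increasing2)
  have "(\<integral>x. norm (f x) \<partial>M) \<le> (\<integral>x. \<delta> + \<delta> powr (1 - p) * norm (f x) powr p \<partial>M)"
    using int le integrable_of_powr_integral[OF assms(1,2) fin]
    by (intro integral_mono) auto
  also have "\<dots> = \<delta> + \<delta> powr (1 - p) * (\<integral>x. norm (f x) powr p \<partial>M)"
    using int by (simp add: prob_space)
  also have "\<dots> \<le> \<delta> + \<delta> powr (1 - p) * e"
    using I by (simp add: mult_left_mono)
  finally show ?thesis .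
qed

text \<open>The Riesz-Fischer argument: a Cauchy sequence for the \<open>p\<close>-th power is
  Cauchy in the mean, so a subsequence converges almost everywhere, and Fatou's lemma turns its
  pointwise limit into a limit of the whole sequence.\<close>

lemma (in prob_space) powr_integral_complete:
  fixes u :: "nat \<Rightarrow> 'a \<Rightarrow> 'b::{banach, second_countable_topology}"
  assumes p: "1 \<le> p" and u [measurable]: "\<And>n. u n \<in> borel_measurable M"
    and fin: "\<And>n. powr_integral p M (u n) < \<infinity>"
    and Cauchy: "\<And>e. 0 < e \<Longrightarrow>
      \<exists>N. \<forall>i\<ge>N. \<forall>j\<ge>N. powr_integral p M (\<lambda>x. u i x - u j x) < ennreal e"
  obtains g where "g \<in> borel_measurable M"
    and "(\<lambda>n. powr_integral p M (\<lambda>x. g x - u n x)) \<longlonglongrightarrow> 0"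
proof -
  have "\<exists>N. \<forall>i\<ge>N. \<forall>j\<ge>N. (\<integral>x. norm (u i x - u j x) \<partial>M) < e" if e: "0 < e" for e :: real
  proof -
    \<comment> \<open>\<open>d\<close> is the factor \<open>\<delta> powr (1 - p)\<close> of the
      preceding estimate at \<open>\<delta> = e / 4\<close>. The tolerance
      \<open>e / (4 * d)\<close> cancels it, for a total of \<open>e / 2\<close>.\<close>
    define d where "d = (e / 4) powr (1 - p)"
    have d: "0 < d" using e by (simp add: d_def)
    obtain N where N: "\<And>i j. i \<ge> N \<Longrightarrow> j \<ge> N \<Longrightarrow>
        powr_integral p M (\<lambda>x. u i x - u j x) < ennreal (e / (4 * d))"
      using Cauchy[of "e / (4 * d)"] e d by auto
    have "(\<integral>x. norm (u i x - u j x) \<partial>M) < e" if "i \<ge> N" "j \<ge> N" for i j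
    proof -
      have "(\<integral>x. norm (u i x - u j x) \<partial>M) \<le> e / 4 + (e / 4) powr (1 - p) * (e / (4 * d))"
        by (rule norm_integral_le_powr_integral[OF p _ _ N[OF that]]) (use e in auto)
      also have "\<dots> < e" using d e by (simp flip: d_def)
      finally show ?thesis .
    qed
    then show ?thesis by blast
  qed
  then obtain r where r: "strict_mono r" and AE: "AE x in M. Cauchy (\<lambda>i. u (r i) x)"
    using cauchy_L1_AE_cauchy_subseq[of M u] integrable_of_powr_integral[OF p u fin] by blast
  define g where "g x = lim (\<lambda>i. u (r i) x)" for x
  have g [measurable]: "g \<in> borel_measurable M"
    unfolding g_def[abs_def] by measurable
  have lim: "AE x in M. (\<lambda>i. u (r i) x) \<longlonglongrightarrow> g x"
    using AE unfolding g_def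
    by eventually_elim (simp add: Cauchy_convergent flip: convergent_LIMSEQ_iff)
  have "(\<lambda>n. powr_integral p M (\<lambda>x. g x - u n x)) \<longlonglongrightarrow> 0"
  proof (rule tendsto_zero_ennreal)
    fix e :: real
    assume e: "0 < e"
    obtain N where N: "\<And>i j. i \<ge> N \<Longrightarrow> j \<ge> N \<Longrightarrow> powr_integral p M (\<lambda>x. u i x - u j x) < ennreal (e / 2)"
      using Cauchy[of "e / 2"] e by auto
    have "powr_integral p M (\<lambda>x. g x - u n x) < ennreal e" if n: "n \<ge> N" for n
    proof -
      \<comment> \<open>Fatou's lemma along the subsequence with \<open>n\<close> fixed: for large
        \<open>i\<close> both \<open>r i\<close> and \<open>n\<close> lie beyond
        \<open>N\<close>.\<close>
      have "powr_integral p M (\<lambda>x. g x - u n x)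
          = (\<integral>\<^sup>+x. liminf (\<lambda>i. ennreal (norm (u (r i) x - u n x) powr p)) \<partial>M)"
        unfolding powr_integral_def
      proof (rule nn_integral_cong_AE, use lim in eventually_elim)
        case (elim x)
        have "(\<lambda>i. ennreal (norm (u (r i) x - u n x) powr p)) \<longlonglongrightarrow> ennreal (norm (g x - u n x) powr p)"
          using p by (intro tendsto_ennrealI tendsto_powr' tendsto_norm tendsto_diff elim) auto
        then show ?case by (rule lim_imp_Liminf[OF sequentially_bot, symmetric])
      qed
      also have "\<dots> \<le> liminf (\<lambda>i. powr_integral p M (\<lambda>x. u (r i) x - u n x))"
        unfolding powr_integral_def by (rule nn_integral_liminf) measurable
      also have "\<dots> \<le> ennreal (e / 2)"
      proof (rule Liminf_le)
        have "r i \<ge> N" if "i \<ge> N" for i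
          using seq_suble[OF r, of i] that by simp
        then show "\<forall>\<^sub>F i in sequentially. powr_integral p M (\<lambda>x. u (r i) x - u n x) \<le> ennreal (e / 2)"
          using N n by (auto simp: eventually_sequentially intro!: exI[of _ N] less_imp_le)
      qed simp
      also have "\<dots> < ennreal e" using e by (simp add: ennreal_less_iff)
      finally show ?thesis .
    qed
    then show "\<forall>\<^sub>F n in sequentially. powr_integral p M (\<lambda>x. g x - u n x) < ennreal e"
      by (auto simp: eventually_sequentially)
  qed
  with g show thesis by (rule that)
qed

section \<open>The operator of a multivalued transformation\<close>

lemma mt_U_scaleR: "mt_U S f x = (1 / real (card (S x))) *\<^sub>R (\<Sum>y\<in>S x. f y)"
  by (simp add: mt_U_def scaleR_conv_of_real)

lemma mt_average_scaleR:
  "mt_average S n f x = (1 / real n) *\<^sub>R (\<Sum>k<n. (mt_U S ^^ k) f x)"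
  by (simp add: mt_average_def scaleR_conv_of_real)

text \<open>Linearity holds for arbitrary \<open>S\<close>: if \<open>S x\<close> is infinite, its
  sum and its cardinality are 0 by convention, so \<open>mt_U S f x\<close> is 0 for every
  \<open>f\<close>.\<close>

lemma mt_U_diff: "mt_U S (\<lambda>x. f x - g x) = (\<lambda>x. mt_U S f x - mt_U S g x)"
  by (simp add: fun_eq_iff mt_U_def sum_subtractf right_diff_distrib)

lemma mt_U_add: "mt_U S (\<lambda>x. f x + g x) = (\<lambda>x. mt_U S f x + mt_U S g x)"
  by (simp add: fun_eq_iff mt_U_def sum.distrib distrib_left)

lemma mt_U_scale: "mt_U S (\<lambda>x. c *\<^sub>R f x) = (\<lambda>x. c *\<^sub>R mt_U S f x)"
  by (simp add: fun_eq_iff mt_U_scaleR scaleR_sum_right)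

lemma mt_U_sum: "mt_U S (\<lambda>x. \<Sum>i\<in>I. f i x) = (\<lambda>x. \<Sum>i\<in>I. mt_U S (f i) x)"
  by (rule ext) (simp add: mt_U_def sum_distrib_left sum.swap[of _ I])

lemma mt_U_nonneg:
  fixes u :: "'a \<Rightarrow> real"
  shows "(\<And>x. 0 \<le> u x) \<Longrightarrow> 0 \<le> mt_U S u x"
  by (simp add: mt_U_def sum_nonneg)

lemma mt_U_pow_sum:
  "(mt_U S ^^ k) (\<lambda>x. \<Sum>i\<in>I. f i x) = (\<lambda>x. \<Sum>i\<in>I. (mt_U S ^^ k) (f i) x)"
  by (induction k) (simp_all add: mt_U_sum)

lemma mt_U_pow_diff:
  "(mt_U S ^^ k) (\<lambda>x. f x - g x) = (\<lambda>x. (mt_U S ^^ k) f x - (mt_U S ^^ k) g x)"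
  by (induction k) (simp_all add: mt_U_diff)

lemma mt_U_pow_add:
  "(mt_U S ^^ k) (\<lambda>x. f x + g x) = (\<lambda>x. (mt_U S ^^ k) f x + (mt_U S ^^ k) g x)"
  by (induction k) (simp_all add: mt_U_add)

lemma mt_U_pow_scale:
  "(mt_U S ^^ k) (\<lambda>x. c *\<^sub>R f x) = (\<lambda>x. c *\<^sub>R (mt_U S ^^ k) f x)"
  by (induction k) (simp_all add: mt_U_scale)

lemma mt_average_diff:
  "mt_average S n (\<lambda>x. f x - g x) x = mt_average S n f x - mt_average S n g x"
  by (simp add: mt_average_def mt_U_pow_diff sum_subtractf right_diff_distrib)

lemma mt_average_add:
  "mt_average S n (\<lambda>x. f x + g x) x = mt_average S n f x + mt_average S n g x"
  by (simp add: mt_average_def mt_U_pow_add sum.distrib distrib_left)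

lemma mt_average_scale:
  "mt_average S n (\<lambda>x. c *\<^sub>R f x) x = c *\<^sub>R mt_average S n f x"
  by (simp add: mt_average_scaleR mt_U_pow_scale scaleR_sum_right mult.commute)

lemma mt_average_sum:
  "mt_average S n (\<lambda>x. \<Sum>i\<in>I. f i x) x = (\<Sum>i\<in>I. mt_average S n (f i) x)"
  unfolding mt_average_def mt_U_pow_sum sum.swap[of _ I] sum_distrib_left ..

text \<open>The sum telescopes. This identity drives both the comparison of averages of bounded
  functions and the invariance of the limit.\<close>

lemma mt_average_U_diff:
  "mt_average S n (mt_U S f) x - mt_average S n f x = (1 / real n) *\<^sub>R ((mt_U S ^^ n) f x - f x)"
proof -
  have "(\<Sum>k<n. (mt_U S ^^ k) (mt_U S f) x) - (\<Sum>k<n. (mt_U S ^^ k) f x)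
      = (\<Sum>k<n. (mt_U S ^^ Suc k) f x - (mt_U S ^^ k) f x)"
    by (simp add: sum_subtractf funpow_swap1)
  also have "\<dots> = (mt_U S ^^ n) f x - f x"
    using sum_lessThan_telescope[of "\<lambda>k. (mt_U S ^^ k) f x" n] by simp
  finally show ?thesis
    by (simp add: mt_average_scaleR scaleR_diff_right[symmetric] del: funpow.simps)
qed

lemma mt_U_average: "mt_U S (mt_average S n f) = mt_average S n (mt_U S f)"
  unfolding mt_average_scaleR[abs_def] mt_U_scale mt_U_sum by (simp add: funpow_swap1)

section \<open>Pointwise estimates for a measure preserving transformation\<close>

locale mt_preserving = prob_space M
  for M :: "'a measure" and S :: "'a \<Rightarrow> 'a set" and m :: nat +
  assumes transformation: "m_transformation m M S"
    and preserving: "mt_measure_preserving M S"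
begin

lemma
  assumes "x \<in> space M"
  shows S_subset: "S x \<subseteq> space M" and S_finite: "finite (S x)" and S_card: "0 < card (S x)"
  using transformation assms by (auto simp: m_transformation_def)

lemma mt_U_cong:
  assumes "\<And>y. y \<in> space M \<Longrightarrow> f y = g y" and "x \<in> space M"
  shows "mt_U S f x = mt_U S g x"
  using S_subset[OF assms(2)] assms(1) by (auto simp: mt_U_def intro!: sum.cong)

lemma norm_mt_U_powr_le:
  assumes "1 \<le> p" and "x \<in> space M"
  shows "norm (mt_U S f x) powr p \<le> mt_U S (\<lambda>y. norm (f y) powr p) x"
  using norm_mean_powr_le[OF assms(1) S_finite[OF assms(2)], of f] by (simp add: mt_U_scaleR)

text \<open>A mean of values of norm at most \<open>C\<close> has norm at most \<open>C\<close>. The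
  induction generalizes \<open>x\<close>, because the hypothesis is applied at the points of
  \<open>S x\<close>.\<close>

lemma norm_mt_U_pow_le:
  assumes "\<And>x. x \<in> space M \<Longrightarrow> norm (f x) \<le> C" and "x \<in> space M"
  shows "norm ((mt_U S ^^ k) f x) \<le> C"
  using assms(2)
proof (induction k arbitrary: x)
  case (Suc k)
  note S = S_subset[OF Suc.prems] S_finite[OF Suc.prems] S_card[OF Suc.prems]
  have "norm (mt_U S ((mt_U S ^^ k) f) x) \<le> (1 / real (card (S x))) * (\<Sum>y\<in>S x. C)"
    unfolding mt_U_scaleR[of S "(mt_U S ^^ k) f"] norm_scaleR
    by (intro mult_mono sum_norm_le Suc.IH) (use S in auto)
  then show ?case using S by (auto split: if_splits)
qed (use assms in auto)

lemma norm_mt_average_le: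
  assumes "\<And>x. x \<in> space M \<Longrightarrow> norm (f x) \<le> C" and "x \<in> space M"
  shows "norm (mt_average S n f x) \<le> C"
proof (cases "n = 0")
  \<comment> \<open>\<open>mt_average S 0 f\<close> is 0 since \<open>1 / 0 = 0\<close>. The claim
    is then \<open>0 \<le> C\<close>, which follows from the bound at \<open>x\<close>.\<close>
  case True
  then show ?thesis
    using order_trans[OF norm_ge_zero assms(1)[OF assms(2)]] by (simp add: mt_average_def)
next
  case False
  have "norm (mt_average S n f x) \<le> (1 / real n) * (\<Sum>k<n. C)"
    unfolding mt_average_scaleR norm_scaleR
    by (intro mult_mono sum_norm_le norm_mt_U_pow_le assms) auto
  then show ?thesis using False by simp
qed

section \<open>Measurability and invariance\<close>

text \<open>Since \<open>S x\<close> lies in the space, the level set \<open>card (S x) = k\<close>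
  is the preimage with indices \<open>k\<close>, \<open>k\<close> of the whole space. The level sets
  of \<open>card (S x \<inter> B)\<close> are countable unions of preimages over
  \<open>k\<close>.\<close>

lemma card_measurable: "(\<lambda>x. card (S x)) \<in> measurable M (count_space UNIV)"
  and card_Int_measurable: "B \<in> sets M \<Longrightarrow> (\<lambda>x. card (S x \<inter> B)) \<in> measurable M (count_space UNIV)"
proof -
  have meas: "mt_preimage M S k l B \<in> sets M" if "B \<in> sets M" for k l B
    using preserving that by (auto simp: mt_measure_preserving_def mt_measurable_def)
  have "(\<lambda>x. card (S x)) -` {k} \<inter> space M = mt_preimage M S k k (space M)" for k
    using S_subset by (auto simp: mt_preimage_def Int_absorb2)
  then show "(\<lambda>x. card (S x)) \<in> measurable M (count_space UNIV)"
    by (auto simp: measurable_count_space_eq2_countable meas)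
  assume B: "B \<in> sets M"
  have "(\<lambda>x. card (S x \<inter> B)) -` {l} \<inter> space M = (\<Union>k. mt_preimage M S k l B)" for l
    by (auto simp: mt_preimage_def)
  then show "(\<lambda>x. card (S x \<inter> B)) \<in> measurable M (count_space UNIV)"
    by (auto simp: measurable_count_space_eq2_countable intro!: meas B)
qed

lemma mt_U_indicator_measurable:
  assumes "B \<in> sets M"
  shows "mt_U S (indicator B :: 'a \<Rightarrow> real) \<in> borel_measurable M"
proof -
  note [measurable] = card_measurable card_Int_measurable[OF assms]
  have "(\<lambda>x. real (card (S x \<inter> B)) / real (card (S x))) \<in> borel_measurable M"
    by measurable
  also have "(\<lambda>x. real (card (S x \<inter> B)) / real (card (S x))) \<in> borel_measurable M
    \<longleftrightarrow> mt_U S (indicator B :: 'a \<Rightarrow> real) \<in> borel_measurable M"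
    by (rule measurable_cong)
      (use sum_mult_indicator[OF S_finite, of _ "\<lambda>_. 1 :: real" "\<lambda>_. B" "\<lambda>y. y"] in
        \<open>simp add: mt_U_def Int_def\<close>)
  finally show ?thesis .
qed

text \<open>Approximation by simple functions: \<open>mt_U\<close> sends them to finite combinations
  of images of indicators, and it preserves pointwise limits because each value is a finite
  mean.\<close>

lemma mt_U_measurable [measurable (raw)]:
  fixes f :: "'a \<Rightarrow> 'b::{real_normed_field, euclidean_space}"
  assumes f: "f \<in> borel_measurable M"
  shows "mt_U S f \<in> borel_measurable M"
proof -
  obtain F where F: "\<And>i. simple_function M (F i)"
      and lim: "\<And>x. x \<in> space M \<Longrightarrow> (\<lambda>i. F i x) \<longlonglongrightarrow> f x"
    using borel_measurable_implies_sequence_metric[OF f, of 0] by auto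
  show ?thesis
  proof (rule borel_measurable_LIMSEQ_metric)
    fix i
    let ?I = "F i ` space M" and ?A = "\<lambda>v. F i -` {v} \<inter> space M"
    note fin = simple_functionD(1)[OF F[of i]] and A = simple_functionD(2)[OF F[of i]]
    have rep: "F i x = (\<Sum>v\<in>?I. (indicator (?A v) x :: real) *\<^sub>R v)" if "x \<in> space M" for x
    proof -
      have "(\<Sum>v\<in>?I. (indicator (?A v) x :: real) *\<^sub>R v) = (\<Sum>v\<in>?I. if F i x = v then v else 0)"
        using that by (intro sum.cong) (auto simp: indicator_def)
      then show ?thesis using that fin by (simp add: sum.delta')
    qed
    have eq: "mt_U S (F i) x = (\<Sum>v\<in>?I. mt_U S (indicator (?A v) :: 'a \<Rightarrow> real) x *\<^sub>R v)"
      if x: "x \<in> space M" for x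
    proof -
      have "mt_U S (F i) x = mt_U S (\<lambda>x. \<Sum>v\<in>?I. (indicator (?A v) x :: real) *\<^sub>R v) x"
        by (rule mt_U_cong[OF rep x])
      also have "\<dots> = (\<Sum>v\<in>?I. mt_U S (\<lambda>x. (indicator (?A v) x :: real) *\<^sub>R v) x)"
        by (subst mt_U_sum) (rule refl)
      also have "\<dots> = (\<Sum>v\<in>?I. mt_U S (indicator (?A v) :: 'a \<Rightarrow> real) x *\<^sub>R v)"
        by (simp add: mt_U_scaleR flip: scaleR_sum_left)
      finally show ?thesis .
    qed
    have "(\<lambda>x. \<Sum>v\<in>?I. mt_U S (indicator (?A v) :: 'a \<Rightarrow> real) x *\<^sub>R v) \<in> borel_measurable M"
      by (intro borel_measurable_sum borel_measurable_scaleR mt_U_indicator_measurable A) simp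
    then show "mt_U S (F i) \<in> borel_measurable M"
      by (simp only: measurable_cong[of M "mt_U S (F i)", OF eq])
  next
    fix x assume "x \<in> space M"
    then show "(\<lambda>i. mt_U S (F i) x) \<longlonglongrightarrow> mt_U S f x"
      unfolding mt_U_scaleR using S_subset by (intro tendsto_intros lim) auto
  qed
qed

lemma mt_U_pow_measurable [measurable (raw)]:
  fixes f :: "'a \<Rightarrow> 'b::{real_normed_field, euclidean_space}"
  shows "f \<in> borel_measurable M \<Longrightarrow> (mt_U S ^^ k) f \<in> borel_measurable M"
  by (induction k) auto

lemma mt_average_measurable [measurable (raw)]:
  fixes f :: "'a \<Rightarrow> 'b::{real_normed_field, euclidean_space}"
  shows "f \<in> borel_measurable M \<Longrightarrow> mt_average S n f \<in> borel_measurable M"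
  unfolding mt_average_scaleR[abs_def] by measurable

text \<open>For indicators this is the hypothesis that the measure is preserved. Linearity and
  monotone convergence extend it to nonnegative functions.\<close>

lemma nn_integral_mt_U:
  fixes u :: "'a \<Rightarrow> real"
  assumes "u \<in> borel_measurable M" and "\<And>x. 0 \<le> u x"
  shows "(\<integral>\<^sup>+x. ennreal (mt_U S u x) \<partial>M) = (\<integral>\<^sup>+x. ennreal (u x) \<partial>M)"
  using assms
proof (induction rule: borel_measurable_induct_real)
  case (set A)
  \<comment> \<open>Boundedness gives integrability, so the Bochner integral in
    \<open>mt_push\<close> is a genuine value and can be compared with
    \<open>nn_integral\<close>.\<close>
  have bound: "norm (mt_U S (indicator A :: 'a \<Rightarrow> real) x) \<le> 1" if "x \<in> space M" for x
    using norm_mt_U_pow_le[of "indicator A :: 'a \<Rightarrow> real" 1 x 1] that by (simp add: indicator_def)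
  have "integrable M (mt_U S (indicator A :: 'a \<Rightarrow> real))"
    by (rule integrable_const_bound[where B=1])
      (use bound set in \<open>auto intro!: mt_U_indicator_measurable\<close>)
  then have "(\<integral>\<^sup>+x. ennreal (mt_U S (indicator A) x) \<partial>M)
      = ennreal (\<integral>x. mt_U S (indicator A :: 'a \<Rightarrow> real) x \<partial>M)"
    by (rule nn_integral_eq_integral) (simp add: mt_U_def sum_nonneg)
  also have "\<dots> = ennreal (measure M A)"
    using preserving set
    by (auto simp: mt_measure_preserving_def mt_push_def mt_kernel_def mt_U_def)
  also have "\<dots> = (\<integral>\<^sup>+x. ennreal (indicator A x) \<partial>M)"
    using set by (simp add: emeasure_eq_measure ennreal_indicator)
  finally show ?case .
next
  case (mult u c)
  have "mt_U S (\<lambda>x. c * u x) x = c * mt_U S u x" for x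
    using mt_U_scale[of S c u] by (simp add: fun_eq_iff)
  with mult show ?case
    by (simp add: mt_U_measurable mt_U_nonneg ennreal_mult nn_integral_cmult)
next
  case (add u v)
  then show ?case
    by (simp add: mt_U_measurable mt_U_nonneg mt_U_add nn_integral_add)
next
  case (seq W)
  have monoU: "mt_U S (W i) x \<le> mt_U S (W j) x" if "i \<le> j" for i j x
    using seq that by (auto simp: mt_U_def incseq_def le_fun_def intro!: divide_right_mono sum_mono)
  have limU: "(\<lambda>i. mt_U S (W i) x) \<longlonglongrightarrow> mt_U S u x" if "x \<in> space M" for x
    unfolding mt_U_scaleR using S_subset[OF that] by (intro tendsto_intros seq) auto
  \<comment> \<open>Monotone convergence is used for the images of the \<open>W i\<close> and for
    the \<open>W i\<close> themselves. The induction hypothesis matches the integrals index by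
    index.\<close>
  have "(\<integral>\<^sup>+x. ennreal (mt_U S u x) \<partial>M) = (\<integral>\<^sup>+x. (SUP i. ennreal (mt_U S (W i) x)) \<partial>M)"
    using limU monoU
    by (intro nn_integral_cong LIMSEQ_unique[OF tendsto_ennrealI LIMSEQ_SUP])
      (auto simp: incseq_def ennreal_leI)
  also have "\<dots> = (SUP i. \<integral>\<^sup>+x. ennreal (mt_U S (W i) x) \<partial>M)"
    using monoU seq by (intro nn_integral_monotone_convergence_SUP)
      (auto simp: incseq_def le_fun_def ennreal_leI)
  also have "\<dots> = (SUP i. \<integral>\<^sup>+x. ennreal (W i x) \<partial>M)"
    by (simp add: seq)
  also have "\<dots> = (\<integral>\<^sup>+x. (SUP i. ennreal (W i x)) \<partial>M)"
    using seq by (intro nn_integral_monotone_convergence_SUP[symmetric])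
      (auto simp: incseq_def le_fun_def ennreal_leI)
  also have "\<dots> = (\<integral>\<^sup>+x. ennreal (u x) \<partial>M)"
    using seq
    by (intro nn_integral_cong LIMSEQ_unique[OF LIMSEQ_SUP tendsto_ennrealI])
      (auto simp: incseq_def le_fun_def ennreal_leI)
  finally show ?case .
qed

section \<open>Contraction\<close>

text \<open>Jensen's inequality on each \<open>S x\<close> bounds the integrand by
  \<open>mt_U\<close> of the \<open>p\<close>-th power of the norm, whose integral is that of the
  power itself.\<close>

lemma powr_integral_mt_U_le:
  fixes f :: "'a \<Rightarrow> 'b::{real_normed_field, euclidean_space}"
  assumes "1 \<le> p" and [measurable]: "f \<in> borel_measurable M"
  shows "powr_integral p M (mt_U S f) \<le> powr_integral p M f"
proof -
  have "powr_integral p M (mt_U S f) \<le> (\<integral>\<^sup>+x. ennreal (mt_U S (\<lambda>y. norm (f y) powr p) x) \<partial>M)"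
    unfolding powr_integral_def
    by (intro nn_integral_mono ennreal_leI norm_mt_U_powr_le assms)
  also have "\<dots> = powr_integral p M f"
    unfolding powr_integral_def by (rule nn_integral_mt_U) auto
  finally show ?thesis .
qed

lemma powr_integral_mt_U_pow_le:
  fixes f :: "'a \<Rightarrow> 'b::{real_normed_field, euclidean_space}"
  assumes "1 \<le> p" and "f \<in> borel_measurable M"
  shows "powr_integral p M ((mt_U S ^^ k) f) \<le> powr_integral p M f"
proof (induction k)
  case (Suc k)
  have "powr_integral p M (mt_U S ((mt_U S ^^ k) f)) \<le> powr_integral p M ((mt_U S ^^ k) f)"
    by (intro powr_integral_mt_U_le mt_U_pow_measurable assms)
  with Suc show ?case by simp
qed simp

lemma powr_integral_mt_average_le:
  fixes f :: "'a \<Rightarrow> 'b::{real_normed_field, euclidean_space}"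
  assumes "1 \<le> p" and [measurable]: "f \<in> borel_measurable M"
  shows "powr_integral p M (mt_average S n f) \<le> powr_integral p M f"
proof (cases "n = 0")
  case True
  then show ?thesis by (simp add: powr_integral_def mt_average_def)
next
  case False
  have "powr_integral p M (mt_average S n f)
      \<le> (\<integral>\<^sup>+x. ennreal (1 / real n) * (\<Sum>k<n. ennreal (norm ((mt_U S ^^ k) f x) powr p)) \<partial>M)"
    unfolding powr_integral_def mt_average_scaleR
    using norm_mean_powr_le[OF assms(1), of "{..<n}" "\<lambda>k. (mt_U S ^^ k) f x" for x]
    by (intro nn_integral_mono) (simp add: sum_nonneg ennreal_leI flip: ennreal_mult)
  also have "\<dots> = ennreal (1 / real n) * (\<Sum>k<n. powr_integral p M ((mt_U S ^^ k) f))"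
    unfolding powr_integral_def by (subst nn_integral_cmult) (auto simp: nn_integral_sum simp del: sum_ennreal)
  also have "\<dots> \<le> ennreal (1 / real n) * (\<Sum>k<n. powr_integral p M f)"
    by (intro mult_left_mono sum_mono powr_integral_mt_U_pow_le assms) auto
  also have "\<dots> = (ennreal (1 / real n) * ennreal (real n)) * powr_integral p M f"
    by (simp add: ennreal_of_nat_eq_real_of_nat mult.assoc)
  also have "\<dots> = powr_integral p M f"
    using False by (simp flip: ennreal_mult)
  finally show ?thesis .
qed

section \<open>Bounded functions\<close>

text \<open>By telescoping, each further application of \<open>mt_U\<close> changes the average of
  length \<open>k\<close> by at most \<open>2 * C / k\<close>.\<close>

lemma norm_mt_average_U_pow_diff_le:
  assumes C: "\<And>x. x \<in> space M \<Longrightarrow> norm (f x) \<le> C" and x: "x \<in> space M"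
  shows "norm (mt_average S k ((mt_U S ^^ j) f) x - mt_average S k f x) \<le> real j * (2 * C / real k)"
proof (induction j)
  case (Suc j)
  let ?g = "(mt_U S ^^ j) f"
  have "norm ((mt_U S ^^ k) ?g x) \<le> C"
    by (rule norm_mt_U_pow_le[OF norm_mt_U_pow_le[OF C]]) (use x in auto)
  moreover have "norm (?g x) \<le> C"
    by (rule norm_mt_U_pow_le[OF C x])
  ultimately have "norm ((mt_U S ^^ k) ?g x - ?g x) \<le> 2 * C"
    using norm_triangle_ineq4[of "(mt_U S ^^ k) ?g x" "?g x"] by linarith
  then have "norm (mt_average S k (mt_U S ?g) x - mt_average S k ?g x) \<le> 2 * C / real k"
    by (simp add: mt_average_U_diff divide_right_mono)
  with Suc have "norm ((mt_average S k (mt_U S ?g) x - mt_average S k ?g x)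
      + (mt_average S k ?g x - mt_average S k f x)) \<le> 2 * C / real k + real j * (2 * C / real k)"
    by (intro norm_triangle_le) linarith
  then show ?case by (simp add: algebra_simps add_divide_distrib)
qed simp

text \<open>The iterated average is the mean over \<open>j < n\<close> of the averages of the
  \<open>j\<close>-th iterates, each controlled by the preceding lemma. For fixed \<open>n\<close>
  the bound vanishes as \<open>k\<close> grows, uniformly in \<open>x\<close>.\<close>

lemma norm_mt_average_average_diff_le:
  assumes C: "\<And>x. x \<in> space M \<Longrightarrow> norm (f x) \<le> C" and x: "x \<in> space M" and n: "1 \<le> n"
  shows "norm (mt_average S k (mt_average S n f) x - mt_average S k f x) \<le> real n * (2 * C / real k)"
proof -
  have C0: "0 \<le> C" using C[OF x] norm_ge_zero order_trans by blast
  have "mt_average S k (mt_average S n f) x - mt_average S k f x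
      = (1 / real n) *\<^sub>R (\<Sum>j<n. mt_average S k ((mt_U S ^^ j) f) x - mt_average S k f x)"
    unfolding mt_average_scaleR[of S n f, abs_def] mt_average_scale mt_average_sum
    using n by (simp add: sum_subtractf scaleR_conv_of_real diff_divide_distrib)
  also have "norm \<dots> \<le> (1 / real n) * (\<Sum>j<n. real n * (2 * C / real k))"
    unfolding norm_scaleR
  proof (intro mult_mono sum_norm_le)
    fix j assume "j \<in> {..<n}"
    then have "real j * (2 * C / real k) \<le> real n * (2 * C / real k)"
      using C0 by (intro mult_right_mono) auto
    then show "norm (mt_average S k ((mt_U S ^^ j) f) x - mt_average S k f x) \<le> real n * (2 * C / real k)"
      using norm_mt_average_U_pow_diff_le[of f C x k j, OF C x] by linarith
  qed auto
  finally show ?thesis using n by simp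
qed

section \<open>Second moments and the Cauchy property of bounded averages\<close>

lemma integrable_norm_square_bounded:
  fixes f :: "'a \<Rightarrow> 'b::{real_normed_vector, second_countable_topology}"
  assumes [measurable]: "f \<in> borel_measurable M" and C: "\<And>x. x \<in> space M \<Longrightarrow> norm (f x) \<le> C"
  shows "integrable M (\<lambda>x. (norm (f x))\<^sup>2)"
  by (rule integrable_const_bound[where B="C\<^sup>2"]) (auto intro!: AE_I2 power_mono C)

text \<open>Factor the difference of squares: the sum of the norms is at most \<open>2 * C\<close>,
  and their difference at most \<open>d\<close>.\<close>

lemma integral_norm_square_le:
  fixes g h :: "'a \<Rightarrow> 'b::{real_normed_vector, second_countable_topology}"
  assumes meas: "g \<in> borel_measurable M" "h \<in> borel_measurable M"
    and C: "\<And>x. x \<in> space M \<Longrightarrow> norm (g x) \<le> C" "\<And>x. x \<in> space M \<Longrightarrow> norm (h x) \<le> C"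
    and d: "\<And>x. x \<in> space M \<Longrightarrow> norm (g x - h x) \<le> d"
  shows "(\<integral>x. (norm (g x))\<^sup>2 \<partial>M) \<le> (\<integral>x. (norm (h x))\<^sup>2 \<partial>M) + 2 * C * d"
proof -
  have int: "integrable M (\<lambda>x. (norm (g x))\<^sup>2)" "integrable M (\<lambda>x. (norm (h x))\<^sup>2)"
    by (rule integrable_norm_square_bounded[OF meas(1) C(1)]
        integrable_norm_square_bounded[OF meas(2) C(2)]; simp)+
  have "(norm (g x))\<^sup>2 \<le> (norm (h x))\<^sup>2 + 2 * C * d" if x: "x \<in> space M" for x
  proof -
    have "(norm (g x))\<^sup>2 - (norm (h x))\<^sup>2 = (norm (g x) + norm (h x)) * (norm (g x) - norm (h x))"
      by (simp add: power2_eq_square algebra_simps)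
    also have "\<dots> \<le> (norm (g x) + norm (h x)) * d"
      using norm_triangle_ineq2[of "g x" "h x"] d[OF x] by (intro mult_left_mono) auto
    also have "\<dots> \<le> 2 * C * d"
      using C[OF x] norm_ge_zero[of "g x - h x"] d[OF x] by (intro mult_right_mono) linarith+
    finally show ?thesis by simp
  qed
  then have "(\<integral>x. (norm (g x))\<^sup>2 \<partial>M) \<le> (\<integral>x. (norm (h x))\<^sup>2 + 2 * C * d \<partial>M)"
    using int by (intro integral_mono) auto
  also have "\<dots> = (\<integral>x. (norm (h x))\<^sup>2 \<partial>M) + 2 * C * d"
    using int by (simp add: prob_space)
  finally show ?thesis .
qed

text \<open>The contraction property for \<open>p = 2\<close>, moved to real integrals, where the
  subtraction in the parallelogram law is available.\<close>

lemma integral_norm_square_mt_average_le: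
  fixes h :: "'a \<Rightarrow> 'b::{real_normed_field, euclidean_space}"
  assumes h: "h \<in> borel_measurable M" and C: "\<And>x. x \<in> space M \<Longrightarrow> norm (h x) \<le> C"
  shows "(\<integral>x. (norm (mt_average S k h x))\<^sup>2 \<partial>M) \<le> (\<integral>x. (norm (h x))\<^sup>2 \<partial>M)"
proof -
  have eq: "powr_integral 2 M g = ennreal (\<integral>x. (norm (g x))\<^sup>2 \<partial>M)"
    if "g \<in> borel_measurable M" "\<And>x. x \<in> space M \<Longrightarrow> norm (g x) \<le> C" for g :: "'a \<Rightarrow> 'b"
    using nn_integral_eq_integral[OF integrable_norm_square_bounded[OF that]]
    by (simp add: powr_integral_def)
  have "ennreal (\<integral>x. (norm (mt_average S k h x))\<^sup>2 \<partial>M) \<le> ennreal (\<integral>x. (norm (h x))\<^sup>2 \<partial>M)"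
    using powr_integral_mt_average_le[OF _ h, of 2 k]
      eq[OF h C] eq[OF mt_average_measurable[OF h] norm_mt_average_le[OF C]] by simp
  then show ?thesis by (simp add: ennreal_le_iff)
qed

lemma mt_average_bounded_L2_Cauchy:
  fixes f :: "'a \<Rightarrow> 'b::{real_normed_field, euclidean_space}"
  assumes f [measurable]: "f \<in> borel_measurable M"
    and C: "\<And>x. x \<in> space M \<Longrightarrow> norm (f x) \<le> C" and e: "0 < e"
  shows "\<exists>N. \<forall>i\<ge>N. \<forall>j\<ge>N. (\<integral>x. (norm (mt_average S i f x - mt_average S j f x))\<^sup>2 \<partial>M) < e"
proof -
  define E where "E h = (\<integral>x. (norm (h x))\<^sup>2 \<partial>M)" for h :: "'a \<Rightarrow> 'b"
  define A where "A n = mt_average S n f" for n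
  define mid where "mid i j x = (1 / 2) *\<^sub>R (A i x + A j x)" for i j x
  have A_meas [measurable]: "A n \<in> borel_measurable M" for n
    unfolding A_def by measurable
  have A_bound: "norm (A n x) \<le> C" if "x \<in> space M" for n x
    unfolding A_def by (rule norm_mt_average_le[OF C that])
  have mid_meas [measurable]: "mid i j \<in> borel_measurable M" for i j
    unfolding mid_def[abs_def] by measurable
  have mid_bound: "norm (mid i j x) \<le> C" if "x \<in> space M" for i j x
    using norm_triangle_ineq[of "A i x" "A j x"] A_bound[OF that, of i] A_bound[OF that, of j]
    by (simp add: mid_def)
  \<comment> \<open>A midpoint of two averages need not be an average, but averaging it over a long
    range nearly reproduces \<open>A k\<close>.\<close>
  have mid_average: "norm (A k x - mt_average S k (mid i j) x) \<le> real (i + j) * (2 * C / real k)"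
    if x: "x \<in> space M" and ij: "1 \<le> i" "1 \<le> j" for i j k x
  proof -
    have "0 \<le> C" using order_trans[OF norm_ge_zero C[OF x]] .
    define c where "c = 2 * C / real k"
    have c: "0 \<le> c" using \<open>0 \<le> C\<close> by (simp add: c_def)
    have "A k x - mt_average S k (mid i j) x
        = - ((1 / 2) *\<^sub>R ((mt_average S k (A i) x - A k x) + (mt_average S k (A j) x - A k x)))"
      unfolding mid_def[abs_def] mt_average_scale mt_average_add
      by (simp add: scaleR_add_right scaleR_diff_right flip: scaleR_add_left)
    also have "norm \<dots> \<le> (1 / 2) * (real i * c + real j * c)"
      unfolding norm_minus_cancel norm_scaleR A_def c_def
      using norm_mt_average_average_diff_le[of f C x i k, OF C x ij(1)]
        norm_mt_average_average_diff_le[of f C x j k, OF C x ij(2)]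
      by (intro mult_mono norm_triangle_le add_mono) auto
    also have "\<dots> \<le> real (i + j) * c"
      using mult_nonneg_nonneg[OF of_nat_0_le_iff c, of "i + j"] by (simp add: algebra_simps)
    finally show ?thesis unfolding c_def .
  qed
  have E_le: "E (A k) \<le> E (mid i j) + (4 * C\<^sup>2 * real (i + j)) / real k"
    if ij: "1 \<le> i" "1 \<le> j" for i j k
  proof -
    have "E (A k) \<le> E (mt_average S k (mid i j)) + 2 * C * (real (i + j) * (2 * C / real k))"
      unfolding E_def
      by (rule integral_norm_square_le[OF A_meas mt_average_measurable[OF mid_meas] A_bound
            norm_mt_average_le[OF mid_bound] mid_average[OF _ ij]])
    also have "E (mt_average S k (mid i j)) \<le> E (mid i j)"
      unfolding E_def by (rule integral_norm_square_mt_average_le[OF mid_meas mid_bound])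
    finally show ?thesis by (simp add: power2_eq_square algebra_simps)
  qed
  \<comment> \<open>Index 0 is excluded because \<open>A 0\<close> is the zero function and would
    force the infimum to be 0.\<close>
  define \<mu> where "\<mu> = (INF n\<in>{1..}. E (A n))"
  have "0 \<le> E h" for h
    unfolding E_def by simp
  then have bdd: "bdd_below ((\<lambda>n. E (A n)) ` {1..})"
    by (auto intro!: bdd_belowI2[where m=0])
  \<comment> \<open>Let \<open>k\<close> tend to infinity in \<open>E_le\<close>, whose left side is
    at least \<mu> for every \<open>k \<ge> 1\<close>.\<close>
  have mid_ge: "\<mu> \<le> E (mid i j)" if "1 \<le> i" "1 \<le> j" for i j
  proof (rule LIMSEQ_le_const)
    show "(\<lambda>k. E (mid i j) + (4 * C\<^sup>2 * real (i + j)) / real k) \<longlonglongrightarrow> E (mid i j)"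
      using tendsto_add[OF tendsto_const lim_const_over_n, of "E (mid i j)" "4 * C\<^sup>2 * real (i + j)"]
      by (simp only: add_0_right)
    have "\<mu> \<le> E (mid i j) + (4 * C\<^sup>2 * real (i + j)) / real k" if "1 \<le> k" for k
      using cINF_lower[OF bdd, of k] E_le[OF \<open>1 \<le> i\<close> \<open>1 \<le> j\<close>, of k] that by (simp add: \<mu>_def)
    then show "\<exists>N. \<forall>k\<ge>N. \<mu> \<le> E (mid i j) + (4 * C\<^sup>2 * real (i + j)) / real k" by blast
  qed
  \<comment> \<open>In the parallelogram law the excess \<open>e / 8\<close> over \<mu> enters with
    total coefficient 4, which leaves \<open>e / 2\<close>.\<close>
  have "\<mu> < \<mu> + e / 8" using e by simp
  then obtain n0 where n0: "1 \<le> n0" "E (A n0) < \<mu> + e / 8"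
    unfolding \<mu>_def by (subst (asm) cINF_less_iff[OF _ bdd]) auto
  \<comment> \<open>Thus \<open>E_le\<close> at \<open>i = j = n0\<close> bounds all late energies
    by nearly \<open>E (A n0)\<close>.\<close>
  have "mid n0 n0 = A n0"
    by (simp add: fun_eq_iff mid_def flip: scaleR_2)
  then have le: "E (A k) \<le> E (A n0) + (4 * C\<^sup>2 * real (n0 + n0)) / real k" for k
    using E_le[OF n0(1) n0(1), of k] by simp
  have "(\<lambda>k. E (A n0) + (4 * C\<^sup>2 * real (n0 + n0)) / real k) \<longlonglongrightarrow> E (A n0)"
    using tendsto_add[OF tendsto_const lim_const_over_n, of "E (A n0)" "4 * C\<^sup>2 * real (n0 + n0)"]
    by (simp only: add_0_right)
  from order_tendstoD(2)[OF this n0(2)] obtain N where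
    N: "\<And>k. k \<ge> N \<Longrightarrow> E (A n0) + (4 * C\<^sup>2 * real (n0 + n0)) / real k < \<mu> + e / 8"
    unfolding eventually_sequentially by blast
  have "(\<integral>x. (norm (A i x - A j x))\<^sup>2 \<partial>M) < e" if ij: "i \<ge> max 1 N" "j \<ge> max 1 N" for i j
  proof -
    have parallelogram: "(norm (A i x - A j x))\<^sup>2
        = 2 * (norm (A i x))\<^sup>2 + 2 * (norm (A j x))\<^sup>2 - 4 * (norm (mid i j x))\<^sup>2" for x
      by (simp add: mid_def power_divide power2_norm_eq_inner inner_commute
          inner_add_left inner_add_right inner_diff_left inner_diff_right field_simps)
    have "(\<integral>x. (norm (A i x - A j x))\<^sup>2 \<partial>M) = 2 * E (A i) + 2 * E (A j) - 4 * E (mid i j)"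
      unfolding parallelogram E_def
      using integrable_norm_square_bounded[OF A_meas A_bound]
        integrable_norm_square_bounded[OF mid_meas mid_bound] by simp
    also have "\<dots> < e"
      using mid_ge[of i j] le[of i] le[of j] N[of i] N[of j] ij e by simp
    finally show ?thesis .
  qed
  then show ?thesis unfolding A_def by blast
qed

text \<open>Differences of averages have norm at most \<open>2 * C\<close>, and on a bounded range
  smallness of the second moment implies smallness of the \<open>p\<close>-th, for exponents on
  either side of 2.\<close>

lemma mt_average_bounded_Cauchy:
  fixes f :: "'a \<Rightarrow> 'b::{real_normed_field, euclidean_space}"
  assumes p: "1 \<le> p" and f [measurable]: "f \<in> borel_measurable M"
    and C: "\<And>x. x \<in> space M \<Longrightarrow> norm (f x) \<le> C" and e: "0 < e"
  shows "\<exists>N. \<forall>i\<ge>N. \<forall>j\<ge>N.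
    powr_integral p M (\<lambda>x. mt_average S i f x - mt_average S j f x) < ennreal e"
proof -
  \<comment> \<open>Up to \<delta> the \<open>p\<close>-th power is at most \<open>e / 2\<close>.
    Between \<delta> and \<open>2 * C\<close> it is at most \<open>K\<close> times the
    square.\<close>
  define \<delta> where "\<delta> = (e / 2) powr (1 / p)"
  define K where "K = (2 * C) powr p / \<delta>\<^sup>2"
  have \<delta>: "0 < \<delta>" "\<delta> powr p = e / 2"
    using e p by (simp_all add: \<delta>_def powr_powr)
  have K: "0 \<le> K" by (simp add: K_def)
  \<comment> \<open>On \<open>[0, 2 * C]\<close> the \<open>p\<close>-th power is dominated by the square, up to \<open>e / 2\<close>.\<close>
  have dom: "t powr p \<le> e / 2 + K * t\<^sup>2" if t: "0 \<le> t" "t \<le> 2 * C" for t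
  proof (cases "t \<le> \<delta>")
    case True
    then have "t powr p \<le> e / 2"
      using powr_mono2[of p t \<delta>] t p \<delta> by simp
    then show ?thesis using K by (simp add: add_increasing2)
  next
    case False
    have "t powr p * \<delta>\<^sup>2 \<le> (2 * C) powr p * t\<^sup>2"
      using t p \<delta> False by (intro mult_mono powr_mono2 power_mono) auto
    then have "t powr p \<le> K * t\<^sup>2"
      using \<delta> by (simp add: K_def field_simps)
    then show ?thesis using e by simp
  qed
  \<comment> \<open>\<open>K + 1\<close> instead of \<open>K\<close> keeps the denominator positive
    and makes \<open>K * (e / (2 * (K + 1)))\<close> strictly smaller than
    \<open>e / 2\<close>.\<close>
  obtain N where N: "\<And>i j. i \<ge> N \<Longrightarrow> j \<ge> N \<Longrightarrow>
      (\<integral>x. (norm (mt_average S i f x - mt_average S j f x))\<^sup>2 \<partial>M) < e / (2 * (K + 1))"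
    using mt_average_bounded_L2_Cauchy[OF f C, of "e / (2 * (K + 1))"] e K by auto
  have "powr_integral p M (\<lambda>x. mt_average S i f x - mt_average S j f x) < ennreal e"
    if "i \<ge> N" "j \<ge> N" for i j
  proof -
    define h where "h x = mt_average S i f x - mt_average S j f x" for x
    have h [measurable]: "h \<in> borel_measurable M"
      unfolding h_def[abs_def] by measurable
    have bound: "norm (h x) \<le> 2 * C" if "x \<in> space M" for x
      unfolding h_def
      using norm_triangle_ineq4[of "mt_average S i f x" "mt_average S j f x"]
        norm_mt_average_le[of f C x i, OF C that] norm_mt_average_le[of f C x j, OF C that] by simp
    have int: "integrable M (\<lambda>x. (norm (h x))\<^sup>2)"
      by (rule integrable_norm_square_bounded[OF h bound])
    have "powr_integral p M h \<le> (\<integral>\<^sup>+x. ennreal (e / 2 + K * (norm (h x))\<^sup>2) \<partial>M)"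
      unfolding powr_integral_def
      by (intro nn_integral_mono ennreal_leI dom bound) auto
    also have "\<dots> = ennreal (\<integral>x. e / 2 + K * (norm (h x))\<^sup>2 \<partial>M)"
      using int e K by (intro nn_integral_eq_integral) auto
    also have "(\<integral>x. e / 2 + K * (norm (h x))\<^sup>2 \<partial>M) = e / 2 + K * (\<integral>x. (norm (h x))\<^sup>2 \<partial>M)"
      using int by (simp add: prob_space)
    also have "ennreal \<dots> < ennreal e"
    proof (rule ennreal_lessI[OF e])
      have "K * (\<integral>x. (norm (h x))\<^sup>2 \<partial>M) \<le> K * (e / (2 * (K + 1)))"
        using N[OF that] K by (intro mult_left_mono) (auto simp: h_def)
      also have "\<dots> < e / 2"
        using K e by (simp add: field_simps)
      finally show "e / 2 + K * (\<integral>x. (norm (h x))\<^sup>2 \<partial>M) < e" by simp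
    qed
    finally show ?thesis unfolding h_def .
  qed
  then show ?thesis by blast
qed

section \<open>The mean ergodic theorem\<close>

text \<open>Replacing \<open>f\<close> by 0 where its norm exceeds \<open>n\<close> changes nothing
  at a given point once \<open>n\<close> is large. Dominated convergence applies with the
  \<open>p\<close>-th power of the norm of \<open>f\<close> as majorant.\<close>

lemma powr_integral_truncation:
  fixes f :: "'a \<Rightarrow> 'b::{real_normed_field, euclidean_space}"
  assumes p: "1 \<le> p" and [measurable]: "f \<in> borel_measurable M"
    and fin: "powr_integral p M f < \<infinity>" and e: "0 < e"
  obtains g C where "g \<in> borel_measurable M" and "\<And>x. norm (g x) \<le> C"
    and "powr_integral p M (\<lambda>x. f x - g x) < ennreal e"
proof -
  define g where "g n x = (if norm (f x) \<le> real n then f x else 0)" for n x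
  have g [measurable]: "g n \<in> borel_measurable M" for n
    unfolding g_def[abs_def] by measurable
  have "(\<lambda>n. powr_integral p M (\<lambda>x. f x - g n x)) \<longlonglongrightarrow> (\<integral>\<^sup>+x. 0 \<partial>M)"
    unfolding powr_integral_def
  proof (rule nn_integral_dominated_convergence[where w="\<lambda>x. ennreal (norm (f x) powr p)"])
    show "AE x in M. (\<lambda>n. ennreal (norm (f x - g n x) powr p)) \<longlonglongrightarrow> 0"
    proof (rule AE_I2)
      fix x
      have "\<forall>\<^sub>F n in sequentially. norm (f x) \<le> real n"
        using filterlim_real_sequentially by (simp add: filterlim_at_top)
      then have "\<forall>\<^sub>F n in sequentially. ennreal (norm (f x - g n x) powr p) = 0"
        by eventually_elim (simp add: g_def)
      then show "(\<lambda>n. ennreal (norm (f x - g n x) powr p)) \<longlonglongrightarrow> 0"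
        by (rule tendsto_eventually)
    qed
  qed (use fin in \<open>auto simp: powr_integral_def g_def\<close>)
  then have "\<forall>\<^sub>F n in sequentially. powr_integral p M (\<lambda>x. f x - g n x) < ennreal e"
    using e by (intro order_tendstoD(2)[of _ 0]) auto
  then obtain n where "powr_integral p M (\<lambda>x. f x - g n x) < ennreal e"
    by (auto simp: eventually_sequentially)
  then show thesis
    by (intro that[of "g n" "real n"]) (auto simp: g_def[of n])
qed

text \<open>Contractivity makes the error of replacing \<open>f\<close> by a bounded
  \<open>g\<close> uniform in \<open>n\<close>, so the Cauchy property passes from \<open>g\<close>
  to \<open>f\<close> through three summands.\<close>

lemma mt_average_Cauchy:
  fixes f :: "'a \<Rightarrow> 'b::{real_normed_field, euclidean_space}"
  assumes p: "1 \<le> p" and f [measurable]: "f \<in> borel_measurable M"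
    and fin: "powr_integral p M f < \<infinity>" and e: "0 < e"
  shows "\<exists>N. \<forall>i\<ge>N. \<forall>j\<ge>N.
    powr_integral p M (\<lambda>x. mt_average S i f x - mt_average S j f x) < ennreal e"
proof -
  \<comment> \<open>Three errors of size \<delta>, multiplied by \<open>3 powr p\<close>, give
    \<open>3 * e / 4\<close>.\<close>
  define \<delta> where "\<delta> = e / (4 * 3 powr p)"
  have \<delta>: "0 < \<delta>" using e by (simp add: \<delta>_def)
  obtain g C where g [measurable]: "g \<in> borel_measurable M" and C: "\<And>x. norm (g x) \<le> C"
    and fg: "powr_integral p M (\<lambda>x. f x - g x) < ennreal \<delta>"
    using powr_integral_truncation[OF p f fin \<delta>] by blast
  obtain N where N: "\<And>i j. i \<ge> N \<Longrightarrow> j \<ge> N \<Longrightarrow>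
      powr_integral p M (\<lambda>x. mt_average S i g x - mt_average S j g x) < ennreal \<delta>"
    using mt_average_bounded_Cauchy[OF p g C \<delta>] by blast
  have approx: "powr_integral p M (\<lambda>x. mt_average S n f x - mt_average S n g x) \<le> ennreal \<delta>" for n
    using powr_integral_mt_average_le[OF p, of "\<lambda>x. f x - g x" n] fg
    by (simp add: mt_average_diff[abs_def])
  have "powr_integral p M (\<lambda>x. mt_average S i f x - mt_average S j f x) < ennreal e"
    if ij: "i \<ge> N" "j \<ge> N" for i j
  proof -
    have "powr_integral p M (\<lambda>x. mt_average S i f x - mt_average S j f x)
        = powr_integral p M (\<lambda>x. (mt_average S i f x - mt_average S i g x)
          + (mt_average S i g x - mt_average S j g x) + (mt_average S j g x - mt_average S j f x))"
      by simp
    also have "\<dots> \<le> ennreal (3 powr p) *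
        (powr_integral p M (\<lambda>x. mt_average S i f x - mt_average S i g x)
        + powr_integral p M (\<lambda>x. mt_average S i g x - mt_average S j g x)
        + powr_integral p M (\<lambda>x. mt_average S j g x - mt_average S j f x))"
      by (rule powr_integral_add3_le[OF p]) measurable
    also have "\<dots> \<le> ennreal (3 powr p) * (ennreal \<delta> + ennreal \<delta> + ennreal \<delta>)"
      using approx[of j] N[OF ij]
      by (intro mult_left_mono add_mono approx)
        (auto simp: powr_integral_minus_commute[of p M "mt_average S j g"])
    also have "\<dots> = ennreal (3 powr p * (3 * \<delta>))"
      using \<delta> by (simp add: algebra_simps flip: ennreal_plus ennreal_mult)
    also have "\<dots> < ennreal e"
      using e by (intro ennreal_lessI) (auto simp: \<delta>_def)
    finally show ?thesis .
  qed
  then show ?thesis by blast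
qed

lemma mean_ergodic:
  fixes f :: "'a \<Rightarrow> 'b::{real_normed_field, euclidean_space}"
  assumes p: "1 \<le> p" and f [measurable]: "f \<in> borel_measurable M"
    and fin: "powr_integral p M f < \<infinity>"
  obtains g where "g \<in> borel_measurable M" and "powr_integral p M g < \<infinity>"
    and "AE x in M. mt_U S g x = g x"
    and "(\<lambda>n. powr_integral p M (\<lambda>x. g x - mt_average S n f x)) \<longlonglongrightarrow> 0"
proof -
  have A_fin: "powr_integral p M (mt_average S n f) < \<infinity>" for n
    using powr_integral_mt_average_le[OF p f, of n] fin by (rule le_less_trans)
  obtain g where g [measurable]: "g \<in> borel_measurable M"
    and lim: "(\<lambda>n. powr_integral p M (\<lambda>x. g x - mt_average S n f x)) \<longlonglongrightarrow> 0"
    using powr_integral_complete[OF p mt_average_measurable[OF f] A_fin mt_average_Cauchy[OF p f fin]]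
    by blast
  have g_fin: "powr_integral p M g < \<infinity>"
  proof -
    obtain n where n: "powr_integral p M (\<lambda>x. g x - mt_average S n f x) < \<infinity>"
      using order_tendstoD(2)[OF lim, of \<infinity>] by (auto simp: eventually_sequentially)
    \<comment> \<open>The summand 0 only fits a sum of two terms to the three-term
      inequality.\<close>
    have "powr_integral p M (\<lambda>x. (g x - mt_average S n f x) + mt_average S n f x + 0)
        \<le> ennreal (3 powr p) * (powr_integral p M (\<lambda>x. g x - mt_average S n f x)
          + powr_integral p M (mt_average S n f) + powr_integral p M (\<lambda>x. 0 :: 'b))"
      by (rule powr_integral_add3_le[OF p]) measurable
    also have "\<dots> < \<infinity>"
      using n A_fin[of n] by (simp add: ennreal_mult_less_top powr_integral_def[of p M "\<lambda>x. 0"])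
    finally show ?thesis by simp
  qed
  \<comment> \<open>The difference is \<open>1 / n\<close> times \<open>(mt_U S ^^ n) f - f\<close>,
    whose \<open>p\<close>-th power integral is bounded independently of \<open>n\<close> by
    contractivity.\<close>
  have telescope: "(\<lambda>n. powr_integral p M (\<lambda>x. mt_average S n (mt_U S f) x - mt_average S n f x)) \<longlonglongrightarrow> 0"
  proof (rule tendsto_sandwich[OF _ _ tendsto_const])
    let ?c = "ennreal (3 powr p) * (powr_integral p M f + powr_integral p M f)"
    have "powr_integral p M (\<lambda>x. mt_average S n (mt_U S f) x - mt_average S n f x)
        \<le> ennreal ((1 / real n) powr p) * ?c" for n
    proof -
      have "powr_integral p M (\<lambda>x. mt_average S n (mt_U S f) x - mt_average S n f x)
          = ennreal ((1 / real n) powr p) * powr_integral p M (\<lambda>x. (mt_U S ^^ n) f x + - f x + 0)"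
        unfolding powr_integral_def mt_average_U_diff
        by (subst nn_integral_cmult[symmetric]) (auto simp: powr_divide simp flip: ennreal_mult)
      also have "powr_integral p M (\<lambda>x. (mt_U S ^^ n) f x + - f x + 0)
          \<le> ennreal (3 powr p) * (powr_integral p M ((mt_U S ^^ n) f)
            + powr_integral p M (\<lambda>x. - f x) + powr_integral p M (\<lambda>x. 0 :: 'b))"
        by (rule powr_integral_add3_le[OF p]) measurable
      also have "\<dots> \<le> ?c"
        using powr_integral_mt_U_pow_le[OF p f, of n]
        by (intro mult_left_mono) (auto simp: powr_integral_def intro: add_right_mono)
      finally show ?thesis by (simp add: mult_left_mono)
    qed
    then show "\<forall>\<^sub>F n in sequentially.
        powr_integral p M (\<lambda>x. mt_average S n (mt_U S f) x - mt_average S n f x)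
          \<le> ennreal ((1 / real n) powr p) * ?c"
      by simp
    have "(\<lambda>n. (1 / real n) powr p) \<longlonglongrightarrow> 0 powr p"
      using p by (intro tendsto_powr' lim_const_over_n tendsto_const) auto
    then have "(\<lambda>n. ennreal ((1 / real n) powr p)) \<longlonglongrightarrow> 0"
      by (simp add: ennreal_tendsto_0_iff)
    moreover have "?c < \<infinity>" using fin by (simp add: ennreal_mult_less_top)
    ultimately show "(\<lambda>n. ennreal ((1 / real n) powr p) * ?c) \<longlonglongrightarrow> 0"
      using ennreal_tendsto_cmult[of ?c "\<lambda>n. ennreal ((1 / real n) powr p)" 0 sequentially]
      by (simp add: mult.commute[of _ ?c])
  qed simp
  \<comment> \<open>The left side is independent of \<open>n\<close>. Inserting the averages, which
    commute with \<open>mt_U\<close>, splits it into \<open>mt_U\<close> of the error, the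
    telescoping term and the error itself; all three tend to 0.\<close>
  have "powr_integral p M (\<lambda>x. mt_U S g x - g x) \<le> 0"
  proof (rule LIMSEQ_le_const)
    let ?b = "\<lambda>n. ennreal (3 powr p) * (powr_integral p M (\<lambda>x. g x - mt_average S n f x)
      + powr_integral p M (\<lambda>x. mt_average S n (mt_U S f) x - mt_average S n f x)
      + powr_integral p M (\<lambda>x. g x - mt_average S n f x))"
    have "(\<lambda>n. ?b n) \<longlonglongrightarrow> ennreal (3 powr p) * (0 + 0 + 0)"
      by (intro ennreal_tendsto_cmult tendsto_add lim telescope) simp
    then show "?b \<longlonglongrightarrow> 0" by simp
    have "powr_integral p M (\<lambda>x. mt_U S g x - g x) \<le> ?b n" for n
    proof -
      have "powr_integral p M (\<lambda>x. mt_U S g x - g x)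
          = powr_integral p M (\<lambda>x. mt_U S (\<lambda>x. g x - mt_average S n f x) x
            + (mt_average S n (mt_U S f) x - mt_average S n f x) + (mt_average S n f x - g x))"
        by (simp add: mt_U_diff mt_U_average)
      also have "\<dots> \<le> ennreal (3 powr p) * (powr_integral p M (mt_U S (\<lambda>x. g x - mt_average S n f x))
          + powr_integral p M (\<lambda>x. mt_average S n (mt_U S f) x - mt_average S n f x)
          + powr_integral p M (\<lambda>x. mt_average S n f x - g x))"
        by (rule powr_integral_add3_le[OF p]) measurable
      also have "\<dots> \<le> ?b n"
        by (intro mult_left_mono add_mono powr_integral_mt_U_le[OF p])
          (auto simp: powr_integral_minus_commute[of p M g])
      finally show ?thesis .
    qed
    then show "\<exists>N. \<forall>n\<ge>N. powr_integral p M (\<lambda>x. mt_U S g x - g x) \<le> ?b n" by blast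
  qed
  then have "AE x in M. mt_U S g x - g x = 0"
    by (intro powr_integral_eq_0[of _ M p]) auto
  then have "AE x in M. mt_U S g x = g x" by simp
  with g g_fin show thesis using lim by (rule that)
qed

end

text \<open>The sort of \<open>'b\<close> covers real and complex values at once: it provides the
  field operations of \<open>mt_U\<close> together with the inner product behind the parallelogram
  law.\<close>

theorem corollary3:
  fixes M :: "'a measure" and S :: "'a \<Rightarrow> 'a set" and m :: nat and p :: real
    and f :: "'a \<Rightarrow> 'b::{real_normed_field, euclidean_space}"
  assumes "prob_space M"
    and "m \<ge> 1"
    and "m_transformation m M S"
    and "mt_measure_preserving M S"
    and "1 \<le> p"
    and "f \<in> Lp_space p M"
  shows "\<exists>g \<in> Lp_space p M.
           (AE x in M. mt_U S g x = g x) \<and>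
           (\<lambda>n. Lp_norm p M (\<lambda>x. g x - mt_average S n f x)) \<longlonglongrightarrow> 0"
proof -
  interpret prob_space M by fact
  interpret mt_preserving M S m
    by unfold_locales (use assms in auto)
  have f: "f \<in> borel_measurable M" "powr_integral p M f < \<infinity>"
    using assms(6) Lp_norm_less_top_iff[of p M f] by (auto simp: Lp_space_def)
  obtain g where g: "g \<in> borel_measurable M" "powr_integral p M g < \<infinity>" "AE x in M. mt_U S g x = g x"
    and lim: "(\<lambda>n. powr_integral p M (\<lambda>x. g x - mt_average S n f x)) \<longlonglongrightarrow> 0"
    using mean_ergodic[OF assms(5) f] by blast
  have "(\<lambda>n. Lp_norm p M (\<lambda>x. g x - mt_average S n f x)) \<longlonglongrightarrow> 0"
    using assms(5) lim by (intro Lp_norm_tendsto_0) auto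
  moreover have "g \<in> Lp_space p M"
    using g Lp_norm_less_top_iff[of p M g] by (simp add: Lp_space_def)
  ultimately show ?thesis using g(3) by blast
qed

end
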